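(* Let $X$ be a finite set with $|X|=n=p^k$, where $p$ is an odd prime and $k\geq 2$. Then the diameter of the commuting graph $\mathcal{G}(\mathcal{I}(X))$ is $5$.
   Context: For a finite set $X$, $\mathcal{I}(X)$ is the symmetric inverse semigroup on $X$: all partial injective transformations of $X$ (injective functions whose domain and image are subsets of $X$) under composition of partial functions. The commuting graph $\mathcal{G}(S)$ of a finite non-commutative semigroup $S$ is the simple graph whose vertices are the elements of $S$ not in the center $Z(S)=\{a\in S: ab=ba\text{ for all }b\in S\}$, two distinct vertices $a,b$ being adjacent iff $ab=ba$. The diameter of a graph is the maximum distance between two of its vertices, where distance is the length (number of edges) of a shortest path, or $\infty$ if no path exists. *)

theory Defs
  imports
    "HOL-Algebra.Group"
    "HOL-Computational_Algebra.Primes"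
    "Graph_Theory.Graph_Theory"
begin

section \<open>The symmetric inverse semigroup\<close>

text \<open>
  A partial transformation of \<open>X\<close> is a map \<open>'a \<rightharpoonup> 'a\<close> whose domain and range lie in \<open>X\<close>.
  The carrier is a monoid with the partial identity on \<open>X\<close> as unit; nothing below
  depends on the unit. Products are composed from right to left; composing from left
  to right gives the opposite semigroup, which has the same commuting pairs.
\<close>

definition sym_inv_semigroup :: "'a set \<Rightarrow> ('a \<rightharpoonup> 'a) monoid" where
  "sym_inv_semigroup X =
    \<lparr>carrier = {f. dom f \<subseteq> X \<and> ran f \<subseteq> X \<and> inj_on f (dom f)},
     monoid.mult = (\<lambda>f g. f \<circ>\<^sub>m g),
     one = Some |` X\<rparr>"

lemma monoid_sym_inv_semigroup: "monoid (sym_inv_semigroup X)"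
proof (rule monoidI)
  fix f g :: "'a \<rightharpoonup> 'a"
  assume "f \<in> carrier (sym_inv_semigroup X)" "g \<in> carrier (sym_inv_semigroup X)"
  then have f: "dom f \<subseteq> X" "ran f \<subseteq> X" "inj_on f (dom f)"
    and g: "dom g \<subseteq> X" "ran g \<subseteq> X" "inj_on g (dom g)"
    by (auto simp: sym_inv_semigroup_def)
  have "inj_on (f \<circ>\<^sub>m g) (dom (f \<circ>\<^sub>m g))"
  proof (rule inj_onI)
    fix x y
    assume "x \<in> dom (f \<circ>\<^sub>m g)" "y \<in> dom (f \<circ>\<^sub>m g)" and eq: "(f \<circ>\<^sub>m g) x = (f \<circ>\<^sub>m g) y"
    then obtain z a b where "g x = Some a" "f a = Some z" "g y = Some b" "f b = Some z"
      by (auto simp: dom_def map_comp_Some_iff)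
    then show "x = y"
      using f(3) g(3) by (metis domI inj_onD)
  qed
  moreover have "dom (f \<circ>\<^sub>m g) \<subseteq> X" "ran (f \<circ>\<^sub>m g) \<subseteq> X"
    using f g by (auto simp: dom_def ran_def map_comp_Some_iff)
  ultimately show "f \<otimes>\<^bsub>sym_inv_semigroup X\<^esub> g \<in> carrier (sym_inv_semigroup X)"
    by (simp add: sym_inv_semigroup_def)
next
  show "\<one>\<^bsub>sym_inv_semigroup X\<^esub> \<in> carrier (sym_inv_semigroup X)"
    by (auto simp: sym_inv_semigroup_def inj_on_def ran_def restrict_map_def split: if_splits)
next
  fix f :: "'a \<rightharpoonup> 'a"
  assume "f \<in> carrier (sym_inv_semigroup X)"
  then have "dom f \<subseteq> X" and "ran f \<subseteq> X"
    by (simp_all add: sym_inv_semigroup_def)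
  then have dom: "\<And>x. x \<notin> X \<Longrightarrow> f x = None" and ran: "\<And>x y. f x = Some y \<Longrightarrow> y \<in> X"
    by (auto simp: ran_def)
  show "\<one>\<^bsub>sym_inv_semigroup X\<^esub> \<otimes>\<^bsub>sym_inv_semigroup X\<^esub> f = f"
    by (auto simp: sym_inv_semigroup_def map_comp_def restrict_map_def fun_eq_iff ran
          split: option.splits)
  show "f \<otimes>\<^bsub>sym_inv_semigroup X\<^esub> \<one>\<^bsub>sym_inv_semigroup X\<^esub> = f"
    by (auto simp: sym_inv_semigroup_def map_comp_def restrict_map_def fun_eq_iff dom)
qed (auto simp: sym_inv_semigroup_def map_comp_def split: option.splits)

section \<open>The commuting graph\<close>

definition semigroup_center :: "('a, 'b) monoid_scheme \<Rightarrow> 'a set" where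
  "semigroup_center S = {a \<in> carrier S. \<forall>b\<in>carrier S. a \<otimes>\<^bsub>S\<^esub> b = b \<otimes>\<^bsub>S\<^esub> a}"

text \<open>An undirected edge is represented by its two orientations.\<close>

definition commuting_graph :: "('a, 'b) monoid_scheme \<Rightarrow> 'a pair_pre_digraph" where
  "commuting_graph S =
    \<lparr>pverts = carrier S - semigroup_center S,
     parcs = {(a, b). a \<in> carrier S - semigroup_center S \<and> b \<in> carrier S - semigroup_center S
                \<and> a \<noteq> b \<and> a \<otimes>\<^bsub>S\<^esub> b = b \<otimes>\<^bsub>S\<^esub> a}\<rparr>"

lemma pair_graph_commuting_graph:
  assumes "finite (carrier S)"
  shows "pair_graph (commuting_graph S)"
proof -
  let ?V = "carrier S - semigroup_center S"
  have "parcs (commuting_graph S) \<subseteq> ?V \<times> ?V"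
    by (auto simp: commuting_graph_def)
  then have "finite (parcs (commuting_graph S))"
    using assms by (meson finite_Diff finite_SigmaI finite_subset)
  then show ?thesis
    using assms
    by unfold_locales (auto simp: commuting_graph_def symmetric_def sym_def)
qed

section \<open>Distance and diameter\<close>

text \<open>
  With unit costs, \<^const>\<open>wf_digraph.\<mu>\<close> is the minimal number of edges of a walk, equivalently
  of a path (see \<open>graph_dist_eq_shortest_path\<close>), and it is \<open>\<infinity>\<close> if there is none.
  The supremum in the diameter is a maximum for finite graphs with at least one vertex.
\<close>

definition graph_dist :: "('a, 'b) pre_digraph \<Rightarrow> 'a \<Rightarrow> 'a \<Rightarrow> ereal" where
  "graph_dist G u v = wf_digraph.\<mu> G (\<lambda>_. 1) u v"

definition graph_diameter :: "('a, 'b) pre_digraph \<Rightarrow> ereal" where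
  "graph_diameter G = (SUP u\<in>verts G. SUP v\<in>verts G. graph_dist G u v)"

lemma (in wf_digraph) graph_dist_eq_shortest_path:
  "graph_dist G u v = (INF p\<in>{p. apath u p v}. ereal (real (length p)))"
proof -
  have cost: "awalk_cost (\<lambda>_. 1) p = real (length p)" for p :: "'b list"
    by (induction p) auto
  have len: "length (awalk_to_apath p) \<le> length p" if "awalk u p v" for p
    using that
  proof (induction rule: awalk_to_apath_induct)
    case (path p)
    then show ?case by (auto simp: awalk_to_apath.simps)
  next
    case (decomp p q r s)
    then have "length (q @ s) \<le> length p"
      by (auto elim!: awalk_cyc_decompE)
    then show ?case
      using decomp step_awalk_to_apath[of u p v q r s] by simp
  qed
  show ?thesis
    unfolding graph_dist_def \<mu>_def cost
  proof (rule antisym)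
    show "(INF p\<in>{p. awalk u p v}. ereal (real (length p)))
        \<le> (INF p\<in>{p. apath u p v}. ereal (real (length p)))"
      by (rule INF_superset_mono) (auto simp: apath_def)
    show "(INF p\<in>{p. apath u p v}. ereal (real (length p)))
        \<le> (INF p\<in>{p. awalk u p v}. ereal (real (length p)))"
    proof (rule INF_greatest)
      fix p assume "p \<in> {p. awalk u p v}"
      then show "(INF p\<in>{p. apath u p v}. ereal (real (length p))) \<le> ereal (real (length p))"
        using len[of p] apath_awalk_to_apath[of u p v]
        by (intro INF_lower2[of "awalk_to_apath p"]) auto
    qed
  qed
qed

end

theory Submission
  imports Defs "HOL-Number_Theory.Cong"
begin

text \<open>
  Upper bound: every noncentral element is within two steps of a proper partial identity, and partial
  identities commute. If \<open>f\<close> is not a permutation, pick \<open>x\<close> outside its range and \<open>y\<close> outside its domain;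
  then \<open>f\<close> commutes with \<open>x \<mapsto> y\<close>, which commutes with the identity on \<open>{x, y}\<close>. If \<open>f\<close> is a
  permutation, it preserves a proper orbit or it is a cycle of length \<open>p\<^sup>k\<close>, and then \<open>f\<^sup>p\<close> does.

  Lower bound: the nonzero elements commuting with a cycle \<open>\<sigma>\<close> of length \<open>n = p\<^sup>k\<close> are its powers, and
  each nontrivial one has \<open>\<sigma>\<close> to the power \<open>n / p\<close> among its own powers. So a walk of length 4 between
  two such cycles \<open>\<sigma>\<close>, \<open>\<rho>\<close> has a midpoint commuting with the \<open>n / p\<close>-th powers of both. The cycles
  are chosen such that only the zero and the identity do.
\<close>

section \<open>Walks in the commuting graph as powers of a relation\<close>

text \<open>Adjacency made reflexive on the noncentral elements: a step may stay in place, so that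
  the \<open>t\<close>-th power captures the walks of length at most \<open>t\<close> between
  noncentral elements, not only those of length exactly \<open>t\<close>.\<close>

definition commuting_rel :: "('a, 'b) monoid_scheme \<Rightarrow> 'a rel" where
  "commuting_rel S = {(a, b). a \<in> carrier S - semigroup_center S \<and> b \<in> carrier S - semigroup_center S
     \<and> a \<otimes>\<^bsub>S\<^esub> b = b \<otimes>\<^bsub>S\<^esub> a}"

lemma wf_digraph_commuting_graph: "wf_digraph (with_proj (commuting_graph S))"
  by unfold_locales (auto simp: commuting_graph_def)

lemma awalk_Nil_commuting_graph:
  "pre_digraph.awalk (with_proj (commuting_graph S)) u [] v \<longleftrightarrow> u = v \<and> u \<in> carrier S - semigroup_center S"
proof -
  interpret wf_digraph "with_proj (commuting_graph S)" by (rule wf_digraph_commuting_graph)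
  have "verts (with_proj (commuting_graph S)) = carrier S - semigroup_center S"
    by (simp add: commuting_graph_def)
  then show ?thesis by (auto simp only: awalk_Nil_iff)
qed

lemma awalk_Cons_commuting_graph:
  "pre_digraph.awalk (with_proj (commuting_graph S)) u (e # p) v \<longleftrightarrow>
    u = fst e \<and> e \<in> commuting_rel S \<and> fst e \<noteq> snd e \<and>
    pre_digraph.awalk (with_proj (commuting_graph S)) (snd e) p v"
proof -
  interpret wf_digraph "with_proj (commuting_graph S)" by (rule wf_digraph_commuting_graph)
  have "arcs (with_proj (commuting_graph S)) = {e. e \<in> commuting_rel S \<and> fst e \<noteq> snd e}"
    "tail (with_proj (commuting_graph S)) = fst" "head (with_proj (commuting_graph S)) = snd"
    by (auto simp: commuting_graph_def commuting_rel_def)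
  then show ?thesis by (auto simp only: awalk_Cons_iff mem_Collect_eq)
qed

lemma awalk_if_commuting_rel:
  assumes "(u, v) \<in> commuting_rel S ^^ t" "u \<in> carrier S - semigroup_center S"
  shows "\<exists>p. pre_digraph.awalk (with_proj (commuting_graph S)) u p v \<and> length p \<le> t"
  using assms
proof (induction t arbitrary: u)
  case 0
  then show ?case by (intro exI[of _ "[]"]) (simp add: awalk_Nil_commuting_graph)
next
  case (Suc t)
  from Suc.prems obtain w where w: "(u, w) \<in> commuting_rel S" "(w, v) \<in> commuting_rel S ^^ t"
    by (meson relpow_Suc_E2)
  moreover from w(1) have "w \<in> carrier S - semigroup_center S" by (simp add: commuting_rel_def)
  ultimately obtain p where p: "pre_digraph.awalk (with_proj (commuting_graph S)) w p v" "length p \<le> t"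
    using Suc.IH[of w] by blast
  show ?case
  proof (cases "u = w")
    case True
    then show ?thesis using p le_SucI by blast
  next
    case False
    then have "pre_digraph.awalk (with_proj (commuting_graph S)) u ((u, w) # p) v"
      using w p by (simp add: awalk_Cons_commuting_graph)
    then show ?thesis using p by (metis Suc_le_mono length_Cons)
  qed
qed

lemma commuting_rel_if_awalk:
  assumes "pre_digraph.awalk (with_proj (commuting_graph S)) u p v" "length p \<le> t"
  shows "(u, v) \<in> commuting_rel S ^^ t"
  using assms
proof (induction t arbitrary: u p)
  case 0
  then show ?case by (simp add: awalk_Nil_commuting_graph)
next
  case (Suc t)
  show ?case
  proof (cases p)
    case Nil
    with Suc.prems have u: "u = v" "u \<in> carrier S - semigroup_center S"
      by (auto simp: awalk_Nil_commuting_graph)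
    then have "(u, u) \<in> commuting_rel S" by (simp add: commuting_rel_def)
    moreover have "(u, v) \<in> commuting_rel S ^^ t"
      by (rule Suc.IH[of u "[]"]) (use u in \<open>simp_all add: awalk_Nil_commuting_graph\<close>)
    ultimately show ?thesis by (metis relpow_Suc_I2)
  next
    case (Cons e q)
    with Suc.prems have e: "u = fst e" "e \<in> commuting_rel S" "length q \<le> t"
      "pre_digraph.awalk (with_proj (commuting_graph S)) (snd e) q v"
      by (simp_all add: awalk_Cons_commuting_graph)
    with Suc.IH[OF e(4,3)] show ?thesis by (metis relpow_Suc_I2 prod.collapse)
  qed
qed

lemma graph_dist_le_if_commuting_rel:
  assumes "(u, v) \<in> commuting_rel S ^^ t" "u \<in> carrier S - semigroup_center S"
  shows "graph_dist (with_proj (commuting_graph S)) u v \<le> ereal (real t)"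
proof -
  interpret wf_digraph "with_proj (commuting_graph S)" by (rule wf_digraph_commuting_graph)
  obtain p where p: "awalk u p v" "length p \<le> t" using awalk_if_commuting_rel[OF assms] by blast
  have cost: "awalk_cost (\<lambda>_. 1) p = real (length p)" for p :: "('a \<times> 'a) list"
    by (induction p) auto
  show ?thesis unfolding graph_dist_def \<mu>_def cost
    by (rule INF_lower2[of p]) (use p in auto)
qed

lemma graph_dist_ge_if_not_commuting_rel:
  assumes "(u, v) \<notin> commuting_rel S ^^ t"
  shows "ereal (real (Suc t)) \<le> graph_dist (with_proj (commuting_graph S)) u v"
proof -
  interpret wf_digraph "with_proj (commuting_graph S)" by (rule wf_digraph_commuting_graph)
  have cost: "awalk_cost (\<lambda>_. 1) p = real (length p)" for p :: "('a \<times> 'a) list"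
    by (induction p) auto
  show ?thesis unfolding graph_dist_def \<mu>_def cost
  proof (rule INF_greatest)
    fix p assume "p \<in> {p. awalk u p v}"
    then have "\<not> length p \<le> t" using commuting_rel_if_awalk[of S u p v t] assms by auto
    then show "ereal (real (Suc t)) \<le> ereal (real (length p))" by simp
  qed
qed

section \<open>Center and idempotents of the symmetric inverse semigroup\<close>

lemma carrier_sym_inv_semigroup:
  "f \<in> carrier (sym_inv_semigroup X) \<longleftrightarrow> dom f \<subseteq> X \<and> ran f \<subseteq> X \<and> inj_on f (dom f)"
  by (simp add: sym_inv_semigroup_def)

lemma mult_sym_inv_semigroup: "f \<otimes>\<^bsub>sym_inv_semigroup X\<^esub> g = f \<circ>\<^sub>m g"
  by (simp add: sym_inv_semigroup_def)

lemma restrict_Some_mem_carrier: "A \<subseteq> X \<Longrightarrow> Some |` A \<in> carrier (sym_inv_semigroup X)"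
  by (auto simp: carrier_sym_inv_semigroup restrict_map_def inj_on_def ran_def split: if_splits)

text \<open>Maps defined at a single point suffice as tests: the idempotent at \<open>x\<close>
  forces \<open>f\<close> to fix \<open>x\<close> if it is defined there, and a map from a domain
  point of \<open>f\<close> to a point of \<open>X\<close> outside the domain rules out a proper
  nonempty domain.\<close>

lemma semigroup_center_sym_inv_semigroup:
  "semigroup_center (sym_inv_semigroup X) = {Map.empty, Some |` X}"
proof (rule Set.set_eqI, rule iffI)
  fix f assume f: "f \<in> semigroup_center (sym_inv_semigroup X)"
  then have fc: "f \<in> carrier (sym_inv_semigroup X)"
    and comm: "\<And>b. b \<in> carrier (sym_inv_semigroup X) \<Longrightarrow> f \<circ>\<^sub>m b = b \<circ>\<^sub>m f"
    by (auto simp: semigroup_center_def mult_sym_inv_semigroup)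
  have fix_pt: "y = x" if "f x = Some y" for x y
  proof -
    have "x \<in> X" using that fc by (auto simp: carrier_sym_inv_semigroup)
    then have "(f \<circ>\<^sub>m Some |` {x}) x = (Some |` {x} \<circ>\<^sub>m f) x"
      using comm[of "Some |` {x}"] restrict_Some_mem_carrier[of "{x}" X] by simp
    then show ?thesis using that by (auto simp: restrict_map_def split: if_splits)
  qed
  show "f \<in> {Map.empty, Some |` X}"
  proof (cases "dom f = {} \<or> dom f = X")
    case True
    then show ?thesis
    proof
      assume d: "dom f = X"
      have "f x = (Some |` X) x" for x
        using fix_pt[of x] d by (cases "f x") (auto simp: restrict_map_def dom_def)
      then show ?thesis by auto
    qed auto
  next
    case False
    moreover have "dom f \<subseteq> X" using fc by (simp add: carrier_sym_inv_semigroup)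
    ultimately obtain a b where ab: "a \<in> dom f" "b \<in> X" "b \<notin> dom f" by blast
    then have "[a \<mapsto> b] \<in> carrier (sym_inv_semigroup X)"
      using fc by (auto simp: carrier_sym_inv_semigroup)
    \<comment> \<open>The left side is \<open>f b = None\<close>, whereas
      \<open>f a = Some a\<close> makes the right side \<open>Some b\<close>.\<close>
    from comm[OF this] have "(f \<circ>\<^sub>m [a \<mapsto> b]) a = ([a \<mapsto> b] \<circ>\<^sub>m f) a" by simp
    then show ?thesis using ab fix_pt[of a] by (auto simp: map_comp_def)
  qed
next
  fix f assume "f \<in> {Map.empty, Some |` X}"
  moreover have "Some |` X \<circ>\<^sub>m b = b \<circ>\<^sub>m Some |` X" if "b \<in> carrier (sym_inv_semigroup X)" for b
    using that
    by (auto simp: fun_eq_iff map_comp_def restrict_map_def carrier_sym_inv_semigroup dom_def ran_def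
        split: option.splits)
  ultimately show "f \<in> semigroup_center (sym_inv_semigroup X)"
    using restrict_Some_mem_carrier[of X X] restrict_Some_mem_carrier[of "{}" X]
    by (auto simp: semigroup_center_def mult_sym_inv_semigroup)
qed

lemma commuting_rel_sym_inv_semigroup:
  "(f, g) \<in> commuting_rel (sym_inv_semigroup X) \<longleftrightarrow>
    f \<in> carrier (sym_inv_semigroup X) \<and> f \<noteq> Map.empty \<and> f \<noteq> Some |` X \<and>
    g \<in> carrier (sym_inv_semigroup X) \<and> g \<noteq> Map.empty \<and> g \<noteq> Some |` X \<and> f \<circ>\<^sub>m g = g \<circ>\<^sub>m f"
  by (auto simp: commuting_rel_def semigroup_center_sym_inv_semigroup mult_sym_inv_semigroup)

lemma restrict_Some_noncentral:
  assumes "A \<subseteq> X" "A \<noteq> {}" "A \<noteq> X"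
  shows "Some |` A \<noteq> Map.empty" "Some |` A \<noteq> Some |` X"
proof -
  have "dom (Some |` A) = A" "dom (Some |` X) = X" by (auto simp: restrict_map_def split: if_splits)
  then show "Some |` A \<noteq> Map.empty" "Some |` A \<noteq> Some |` X"
    using assms by (metis dom_empty, metis)
qed

text \<open>If no arrow of \<open>f\<close> crosses the boundary of \<open>A\<close>, both products
  with the identity on \<open>A\<close> are the restriction of \<open>f\<close> to \<open>A\<close>.
  Hence closure is required in both directions.\<close>

lemma commuting_rel_restrict_Some:
  assumes "f \<in> carrier (sym_inv_semigroup X)" "f \<noteq> Map.empty" "f \<noteq> Some |` X"
    and A: "A \<subseteq> X" "A \<noteq> {}" "A \<noteq> X"
    and closed: "\<And>x y. f x = Some y \<Longrightarrow> x \<in> A \<longleftrightarrow> y \<in> A"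
  shows "(f, Some |` A) \<in> commuting_rel (sym_inv_semigroup X)"
proof -
  have "f \<circ>\<^sub>m Some |` A = Some |` A \<circ>\<^sub>m f"
    using closed by (auto simp: fun_eq_iff map_comp_def restrict_map_def split: option.splits)
  then show ?thesis
    using assms restrict_Some_mem_carrier[OF A(1)] restrict_Some_noncentral[OF A]
    by (simp add: commuting_rel_sym_inv_semigroup)
qed

lemma commuting_rel_idempotents:
  assumes "A \<subseteq> X" "A \<noteq> {}" "A \<noteq> X" "B \<subseteq> X" "B \<noteq> {}" "B \<noteq> X"
  shows "(Some |` A, Some |` B) \<in> commuting_rel (sym_inv_semigroup X)"
  using restrict_Some_mem_carrier[OF assms(1)] restrict_Some_noncentral[OF assms(1-3)]
  by (rule commuting_rel_restrict_Some) (use assms in \<open>auto simp: restrict_map_def split: if_splits\<close>)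

section \<open>Two steps from a noncentral element to an idempotent\<close>

lemma commuting_rel_relpow_idempotent_nonperm:
  assumes fin: "finite X" and card: "card X \<ge> 3"
    and f: "f \<in> carrier (sym_inv_semigroup X)" "f \<noteq> Map.empty" "dom f \<noteq> X"
  shows "\<exists>A. A \<subseteq> X \<and> A \<noteq> {} \<and> A \<noteq> X \<and> (f, Some |` A) \<in> commuting_rel (sym_inv_semigroup X) ^^ 2"
proof -
  have fc: "dom f \<subseteq> X" "ran f \<subseteq> X" "inj_on f (dom f)"
    using f by (auto simp: carrier_sym_inv_semigroup)
  then obtain y where y: "y \<in> X" "y \<notin> dom f" using f(3) by blast
  have "ran f = the ` f ` dom f" by (force simp: ran_def dom_def image_iff)
  then have "card (ran f) \<le> card (dom f)"
    using fin fc(1) by (metis card_image_le finite_subset finite_imageI order_trans)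
  also have "\<dots> < card X" using fin fc(1) f(3) by (simp add: psubset_card_mono psubsetI)
  finally obtain x where x: "x \<in> X" "x \<notin> ran f" by (metis fc(2) nless_le subsetI subset_antisym)
  \<comment> \<open>Both products of \<open>f\<close> and \<open>g\<close> are empty, as
    \<open>f\<close> is undefined at \<open>y\<close> and never takes the value \<open>x\<close>.
    The points may coincide; three elements in \<open>X\<close> keep \<open>{x, y}\<close> proper in
    either case.\<close>
  define g where "g = [x \<mapsto> y]"
  have gc: "g \<in> carrier (sym_inv_semigroup X)"
    using x y by (auto simp: g_def carrier_sym_inv_semigroup)
  have sub: "{x, y} \<subseteq> X" using x y by auto
  have "card {x, y} \<le> 2" by (simp add: card_insert_if)
  then have ne: "{x, y} \<noteq> X" using card by auto
  have g: "g \<noteq> Map.empty" "g \<noteq> Some |` X"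
  proof -
    show "g \<noteq> Map.empty" by (auto simp: g_def)
    have "dom g = {x}" "dom (Some |` X) = X" by (auto simp: g_def restrict_map_def split: if_splits)
    moreover have "X \<noteq> {x}" using card by auto
    ultimately show "g \<noteq> Some |` X" by metis
  qed
  have "f \<noteq> Some |` X" using f(3) by (auto simp: dom_def restrict_map_def split: if_splits)
  moreover have "f \<circ>\<^sub>m g = g \<circ>\<^sub>m f"
    using x y by (auto simp: g_def fun_eq_iff map_comp_def ran_def dom_def split: option.splits)
  ultimately have "(f, g) \<in> commuting_rel (sym_inv_semigroup X)"
    using f gc g by (simp add: commuting_rel_sym_inv_semigroup)
  moreover have "(g, Some |` {x, y}) \<in> commuting_rel (sym_inv_semigroup X)"
    using gc g sub _ ne
    by (rule commuting_rel_restrict_Some) (auto simp: g_def split: if_splits)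
  ultimately show ?thesis using sub ne
    by (intro exI[of _ "{x, y}"]) (auto simp: numeral_2_eq_2)
qed

text \<open>Two of the exponents \<open>0\<close> to \<open>card X\<close> give the same iterate by
  the pigeonhole principle. Cancelling the smaller one yields a period
  \<open>d \<le> card X\<close>; since the first \<open>d\<close> iterates exhaust \<open>X\<close>,
  \<open>d = card X\<close> and they are distinct.\<close>

lemma cyclic_enumeration:
  assumes F: "bij_betw F X X" and x: "x \<in> X" and fin: "finite X"
    and orb: "X = range (\<lambda>i. (F ^^ i) x)"
  shows "(F ^^ i) x = (F ^^ j) x \<longleftrightarrow> i mod card X = j mod card X"
proof -
  let ?h = "\<lambda>i. (F ^^ i) x"
  have hX: "?h i \<in> X" for i using orb by blast
  have "\<not> inj_on ?h {..card X}"
    using card_inj_on_le[of ?h "{..card X}" X] fin hX by auto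
  then obtain a b where ab: "?h a = ?h b" "a < b" "b \<le> card X"
    by (auto simp: inj_on_def) (metis linorder_neqE_nat)
  define d where "d = b - a"
  have d: "0 < d" "d \<le> card X" using ab by (auto simp: d_def)
  have "bij_betw (F ^^ a) X X" using F by (induction a) (auto intro: bij_betw_trans)
  moreover have "(F ^^ a) (?h d) = (F ^^ a) x"
    using ab by (simp add: d_def flip: funpow_add comp_apply[of "F ^^ a"])
  ultimately have hd: "?h d = x" using hX[of d] x by (auto simp: bij_betw_def inj_on_def)
  have per: "?h i = ?h (i mod d)" for i
    by (rule funpow_mod_eq[OF hd, symmetric])
  then have img: "X = ?h ` {..<d}"
    using orb d(1) by (auto simp: image_iff) (metis mod_less_divisor lessThan_iff)
  then have dn: "d = card X" using d(2) card_image_le[of "{..<d}" ?h] by simp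
  then have "inj_on ?h {..<d}" using img by (intro eq_card_imp_inj_on) auto
  then show ?thesis using per[of i] per[of j] d(1) dn
    by (metis inj_on_def lessThan_iff mod_less_divisor)
qed

text \<open>The forward orbit is mapped injectively into itself, hence onto itself by finiteness.
  This gives the closure under preimages that commuting with the identity on the orbit
  requires.\<close>

lemma orbit_mem_iff:
  assumes F: "bij_betw F X X" and fin: "finite X" and x: "x \<in> X" and u: "u \<in> X"
  shows "u \<in> range (\<lambda>i. (F ^^ i) x) \<longleftrightarrow> F u \<in> range (\<lambda>i. (F ^^ i) x)"
proof -
  let ?A = "range (\<lambda>i. (F ^^ i) x)"
  have "(F ^^ i) x \<in> X" for i
    using F x by (induction i) (auto simp: bij_betw_def)
  then have A: "?A \<subseteq> X" by auto
  have "(F ^^ Suc i) x \<in> ?A" for i by blast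
  then have sub: "F ` ?A \<subseteq> ?A" by auto
  moreover have "inj_on F ?A" using F A by (metis bij_betw_def inj_on_subset)
  moreover have "finite ?A" using A fin by (rule finite_subset)
  ultimately have "F ` ?A = ?A" using endo_inj_surj by metis
  then have "\<exists>a\<in>?A. F u = F a" if "F u \<in> ?A" using that by (metis imageE)
  then show ?thesis
    using sub A u F by (metis (no_types, lifting) bij_betw_def image_subset_iff inj_onD subsetD)
qed

lemma perm_mem_carrier:
  assumes "bij_betw F X X"
  shows "(Some \<circ> F) |` X \<in> carrier (sym_inv_semigroup X)"
proof -
  have "dom ((Some \<circ> F) |` X) = X" "ran ((Some \<circ> F) |` X) = F ` X"
    by (auto simp: restrict_map_def ran_def dom_def split: if_splits)
  then show ?thesis
    using assms by (auto simp: carrier_sym_inv_semigroup bij_betw_def inj_on_def)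
qed

lemma total_mem_carrier:
  assumes "f \<in> carrier (sym_inv_semigroup X)" "dom f = X" "finite X"
  obtains F where "bij_betw F X X" "f = (Some \<circ> F) |` X"
proof
  let ?F = "the \<circ> f"
  have f: "ran f \<subseteq> X" "inj_on f X" using assms by (auto simp: carrier_sym_inv_semigroup)
  have Some: "f x = Some (?F x)" if "x \<in> X" for x
    using assms(2) that by auto
  have "inj_on ?F X" using f(2) Some by (metis inj_on_def)
  moreover have "?F ` X \<subseteq> X" using f(1) Some by (auto intro!: ranI)
  ultimately show "bij_betw ?F X X"
    using endo_inj_surj[OF assms(3)] unfolding bij_betw_def by blast
  show "f = (Some \<circ> ?F) |` X"
  proof
    fix x
    show "f x = ((Some \<circ> ?F) |` X) x"
      using Some[of x] assms(2) by (cases "x \<in> X") (auto simp: restrict_map_def dom_def)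
  qed
qed

lemma perm_eq_iff: "(Some \<circ> F) |` X = (Some \<circ> G) |` X \<longleftrightarrow> (\<forall>x\<in>X. F x = G x)"
  by (auto simp: fun_eq_iff restrict_map_def)

lemma commuting_rel_relpow_idempotent_perm:
  assumes fin: "finite X" and card: "card X = p ^ k" and p: "prime p" and k: "k \<ge> 2"
    and f: "f \<in> carrier (sym_inv_semigroup X)" "f \<noteq> Some |` X" "dom f = X"
  shows "\<exists>A. A \<subseteq> X \<and> A \<noteq> {} \<and> A \<noteq> X \<and> (f, Some |` A) \<in> commuting_rel (sym_inv_semigroup X) ^^ 2"
proof -
  obtain F where F: "bij_betw F X X" and fF: "f = (Some \<circ> F) |` X"
    using total_mem_carrier[OF f(1,3) fin] .
  have p2: "p \<ge> 2" using p by (rule prime_ge_2_nat)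
  have pn: "p < p ^ k" using power_strict_increasing[of 1 k p] p2 k by simp
  then obtain x where x: "x \<in> X" using card by (cases "X = {}") auto
  have f0: "f \<noteq> Map.empty" using f(3) x by auto
  have orbX: "range (\<lambda>i. (G ^^ i) x) \<subseteq> X" if "bij_betw G X X" for G
  proof -
    have "(G ^^ i) x \<in> X" for i
      using that x by (induction i) (auto simp: bij_betw_def)
    then show ?thesis by auto
  qed
  have idem: "((Some \<circ> G) |` X, Some |` range (\<lambda>i. (G ^^ i) x)) \<in> commuting_rel (sym_inv_semigroup X)"
    if G: "bij_betw G X X" "(Some \<circ> G) |` X \<noteq> Some |` X" "range (\<lambda>i. (G ^^ i) x) \<noteq> X" for G
  proof (rule commuting_rel_restrict_Some[OF perm_mem_carrier[OF G(1)] _ G(2) orbX[OF G(1)] _ G(3)])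
    show "(Some \<circ> G) |` X \<noteq> Map.empty" using x by (auto simp: fun_eq_iff restrict_map_def)
    show "u \<in> range (\<lambda>i. (G ^^ i) x) \<longleftrightarrow> v \<in> range (\<lambda>i. (G ^^ i) x)"
      if "((Some \<circ> G) |` X) u = Some v" for u v
      using that orbit_mem_iff[OF G(1) fin x, of u] by (auto simp: restrict_map_def split: if_splits)
  qed auto
  \<comment> \<open>Fills up to exactly two steps when the orbit of \<open>f\<close> is already
    proper and one step suffices.\<close>
  have ff: "(f, f) \<in> commuting_rel (sym_inv_semigroup X)"
    using f f0 by (simp add: commuting_rel_sym_inv_semigroup)
  show ?thesis
  proof (cases "range (\<lambda>i. (F ^^ i) x) = X")
    case False
    then have "(f, Some |` range (\<lambda>i. (F ^^ i) x)) \<in> commuting_rel (sym_inv_semigroup X)"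
      using idem[OF F] f(2) fF by simp
    then show ?thesis using ff False orbX[OF F]
      by (intro exI[of _ "range (\<lambda>i. (F ^^ i) x)"]) (auto simp: numeral_2_eq_2)
  next
    case True
    note cyc = cyclic_enumeration[OF F x fin True[symmetric]]
    let ?G = "F ^^ p"
    let ?A = "range (\<lambda>i. (?G ^^ i) x)"
    have G: "bij_betw ?G X X" using F by (induction p) (auto intro: bij_betw_trans)
    \<comment> \<open>This is where \<open>k \<ge> 2\<close> enters: \<open>p\<close> is not a
      multiple of \<open>p ^ k\<close>, so the \<open>p\<close>-th power is not the
      identity.\<close>
    have "?G x \<noteq> x" using cyc[of p 0] pn p2 card by auto
    then have G1: "(Some \<circ> ?G) |` X \<noteq> Some |` X"
      using x perm_eq_iff[of ?G X id] by auto
    \<comment> \<open>Iterates of \<open>?G\<close> reach only exponents that are multiples of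
      \<open>p\<close>, also after reduction modulo \<open>p ^ k\<close>, while \<open>F x\<close>
      has exponent 1.\<close>
    have "F x \<notin> ?A"
    proof
      assume "F x \<in> ?A"
      then obtain i where "(F ^^ 1) x = (F ^^ (p * i)) x" by (auto simp: funpow_mult)
      then have "1 mod p ^ k = (p * i) mod p ^ k" using cyc card by metis
      then have "1 mod p = (p * i) mod p"
        using k by (metis dvd_power mod_mod_cancel not_numeral_le_zero gr0I)
      then show False using p2 by simp
    qed
    moreover have "F x \<in> X" using F x by (auto simp: bij_betw_def)
    ultimately have A: "?A \<noteq> X" by blast
    have "(\<forall>u\<in>X. F (?G u) = ?G (F u))" by (metis comp_apply funpow_swap1)
    then have "f \<circ>\<^sub>m ((Some \<circ> ?G) |` X) = ((Some \<circ> ?G) |` X) \<circ>\<^sub>m f"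
      using F G by (auto simp: fF fun_eq_iff map_comp_def restrict_map_def bij_betw_def)
    moreover have "(Some \<circ> ?G) |` X \<noteq> Map.empty" using x by (auto simp: fun_eq_iff restrict_map_def)
    ultimately have "(f, (Some \<circ> ?G) |` X) \<in> commuting_rel (sym_inv_semigroup X)"
      using f f0 G1 perm_mem_carrier[OF G] by (simp add: commuting_rel_sym_inv_semigroup)
    with idem[OF G G1 A] show ?thesis using A orbX[OF G]
      by (intro exI[of _ ?A]) (auto simp: numeral_2_eq_2)
  qed
qed

section \<open>Centralizers of a cycle of prime power length\<close>

text \<open>Every nontrivial subgroup of the integers modulo \<open>p ^ k\<close> contains the one
  of order \<open>p\<close>: the gcd of \<open>r\<close> and \<open>p ^ k\<close> is
  \<open>p ^ a\<close> with \<open>a < k\<close>, a multiple of \<open>r\<close> by Bezout, and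
  scaling it gives \<open>p ^ (k - 1)\<close>.\<close>

lemma ex_mult_cong_prime_power:
  fixes p k r :: nat
  assumes p: "prime p" and r: "r mod p ^ k \<noteq> 0"
  shows "\<exists>t. [t * r = p ^ (k - 1)] (mod p ^ k)"
proof -
  obtain a where a: "a \<le> k" "gcd r (p ^ k) = p ^ a"
    using divides_primepow_nat[OF p, of "gcd r (p ^ k)" k] by auto
  have "a \<noteq> k" using a(2) r by (metis gcd_dvd1 mod_0_imp_dvd dvd_imp_mod_0)
  with a have e: "p ^ (k - 1) = p ^ a * p ^ (k - 1 - a)"
    by (simp flip: power_add)
  obtain y where "[r * y = p ^ a] (mod p ^ k)" using cong_solve_nat[of r "p ^ k"] a by auto
  then have "[r * y * p ^ (k - 1 - a) = p ^ a * p ^ (k - 1 - a)] (mod p ^ k)"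
    by (rule cong_scalar_right)
  then show ?thesis using e by (intro exI[of _ "y * p ^ (k - 1 - a)"]) (simp add: mult_ac)
qed

text \<open>Commuting with the cycle \<open>f\<close> makes \<open>c\<close> a nontrivial power of
  \<open>f\<close>, so some power of \<open>c\<close> is the \<open>p ^ (k - 1)\<close>-th power of
  \<open>f\<close>. As \<open>d\<close> commutes with \<open>c\<close>, it commutes with that power;
  the conclusion says so arrow by arrow, since \<open>d\<close> may be partial.\<close>

lemma cycle_second_centralizer:
  fixes h :: "nat \<Rightarrow> 'a" and p k :: nat
  assumes p: "prime p"
    and X: "range h = X" and h: "\<And>i j. h i = h j \<longleftrightarrow> i mod p ^ k = j mod p ^ k"
    and f: "\<And>i. f (h i) = Some (h (Suc i))"
    and c: "(f, c) \<in> commuting_rel (sym_inv_semigroup X)"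
    and d: "(c, d) \<in> commuting_rel (sym_inv_semigroup X)"
    and dij: "d (h i) = Some (h j)"
  shows "d (h (i + p ^ (k - 1))) = Some (h (j + p ^ (k - 1)))"
proof -
  let ?n = "p ^ k"
  have n: "?n > 0" using p by (simp add: prime_gt_0_nat)
  have cc: "dom c \<subseteq> X" "ran c \<subseteq> X" "c \<noteq> Map.empty" "c \<noteq> Some |` X" "f \<circ>\<^sub>m c = c \<circ>\<^sub>m f"
    using c by (auto simp: commuting_rel_sym_inv_semigroup carrier_sym_inv_semigroup)
  have dc: "ran d \<subseteq> X" "c \<circ>\<^sub>m d = d \<circ>\<^sub>m c"
    using d by (auto simp: commuting_rel_sym_inv_semigroup carrier_sym_inv_semigroup)
  obtain x y where xy: "c x = Some y" using cc(3) by fastforce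
  then have "x \<in> X" "y \<in> X" using cc(1,2) by (auto intro: ranI)
  then obtain a b where "x = h a" "y = h b" using X by auto
  with xy have ab: "c (h a) = Some (h b)" by simp
  \<comment> \<open>A single arrow of \<open>c\<close> is carried around the whole cycle by
    \<open>f\<close>.\<close>
  have shift: "c (h (a + t)) = Some (h (b + t))" for t
  proof (induction t)
    case (Suc t)
    have "(f \<circ>\<^sub>m c) (h (a + t)) = (c \<circ>\<^sub>m f) (h (a + t))" by (simp add: cc(5))
    then show ?case using Suc f by simp
  qed (use ab in simp)
  \<comment> \<open>This is \<open>b - a\<close> modulo \<open>?n\<close>; the multiple
    \<open>?n * a \<ge> a\<close> avoids truncated subtraction.\<close>
  define r where "r = b + (?n * a - a)"
  have cr: "c (h i) = Some (h (i + r))" for i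
  proof -
    have le: "a \<le> ?n * a" using n by (metis mult_le_mono1 nat_mult_1 Suc_leI One_nat_def)
    then have "a + ((?n * a - a) + i) = i + ?n * a" "b + ((?n * a - a) + i) = i + r"
      unfolding r_def by linarith+
    moreover have "h (i + ?n * a) = h i" by (simp add: h)
    ultimately show ?thesis using shift[of "(?n * a - a) + i"] by metis
  qed
  have "r mod ?n \<noteq> 0"
  proof
    assume "r mod ?n = 0"
    then have "h (i + r) = h i" for i unfolding h by (metis add.right_neutral mod_add_right_eq)
    with cr have "c (h i) = Some (h i)" for i by simp
    then have "c u = Some u" if "u \<in> X" for u using that X by auto
    moreover have "c u = None" if "u \<notin> X" for u using that cc(1) by auto
    ultimately have "c = Some |` X" by (auto simp: fun_eq_iff restrict_map_def)
    with cc(4) show False ..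
  qed
  from ex_mult_cong_prime_power[OF p this] obtain t where t: "(t * r) mod ?n = p ^ (k - 1) mod ?n"
    by (auto simp: cong_def)
  have "d (h (i + s * r)) = Some (h (j + s * r))" for s
  proof (induction s)
    case (Suc s)
    have "(c \<circ>\<^sub>m d) (h (i + s * r)) = (d \<circ>\<^sub>m c) (h (i + s * r))" by (simp add: dc(2))
    then show ?case using Suc cr by (simp add: add_ac)
  qed (use dij in simp)
  from this[of t] show ?thesis
    using t h by (metis mod_add_right_eq)
qed

lemma ex_cycle:
  fixes h :: "nat \<Rightarrow> 'a"
  assumes n: "n \<ge> 2" and X: "range h = X" and h: "\<And>i j. h i = h j \<longleftrightarrow> i mod n = j mod n"
  shows "\<exists>f. f \<in> carrier (sym_inv_semigroup X) \<and> f \<noteq> Map.empty \<and> f \<noteq> Some |` X \<and>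
    (\<forall>i. f (h i) = Some (h (Suc i)))"
proof -
  \<comment> \<open>Any index of \<open>x\<close> serves, because \<open>h\<close> depends only on
    the index modulo \<open>n\<close>.\<close>
  define F where "F x = h (Suc (SOME i. h i = x))" for x
  have F: "F (h i) = h (Suc i)" for i
  proof -
    have "h (SOME j. h j = h i) = h i" by (rule someI) simp
    then show ?thesis unfolding F_def h by (metis mod_Suc_eq)
  qed
  have "inj_on F X"
  proof (rule inj_onI)
    fix x y assume xy: "x \<in> X" "y \<in> X" "F x = F y"
    then obtain i j where ij: "x = h i" "y = h j" using X by auto
    with xy F have "h (Suc i) = h (Suc j)" by simp
    then have "[i + 1 = j + 1] (mod n)" by (simp add: h cong_def)
    then have "[i = j] (mod n)" by (simp only: cong_add_rcancel_nat)
    then have "i mod n = j mod n" by (simp only: cong_def)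
    then show "x = y" by (simp add: ij h)
  qed
  moreover have "F ` X = X"
  proof -
    have "h i \<in> F ` X" for i
    proof -
      have "h i = h (Suc (i + (n - 1)))" using n by (simp add: h)
      then show ?thesis using F X by (metis rangeI image_eqI)
    qed
    then show ?thesis using F X by auto
  qed
  ultimately have "bij_betw F X X" by (simp add: bij_betw_def)
  note mem = perm_mem_carrier[OF this]
  have f: "((Some \<circ> F) |` X) (h i) = Some (h (Suc i))" for i
    using F X by auto
  have "h (Suc 0) \<noteq> h 0" using n by (simp add: h)
  then have "((Some \<circ> F) |` X) (h 0) \<noteq> (Some |` X) (h 0)" using f[of 0] X by auto
  then have "(Some \<circ> F) |` X \<noteq> Some |` X" by auto
  moreover have "(Some \<circ> F) |` X \<noteq> Map.empty" using f[of 0] by auto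
  ultimately show ?thesis using mem f by blast
qed

section \<open>Two permutations of a grid and what commutes with both\<close>

text \<open>Cell \<open>(s, j)\<close> receives the index \<open>s + j * m\<close>. Adding
  \<open>m\<close> to an index keeps \<open>s\<close> and advances \<open>j\<close> cyclically, so
  the \<open>m\<close>-th power of the cycle along this numbering is the row shift.\<close>

lemma grid_enumeration:
  fixes g :: "nat \<times> nat \<Rightarrow> 'a" and m p :: nat
  assumes g: "bij_betw g ({..<m} \<times> {..<p}) X" and m: "m > 0" and p: "p > 0"
  shows "range (\<lambda>i. g (i mod m, i div m mod p)) = X"
    and "g (i mod m, i div m mod p) = g (j mod m, j div m mod p) \<longleftrightarrow> i mod (m * p) = j mod (m * p)"
proof -
  let ?h = "\<lambda>i. g (i mod m, i div m mod p)"
  have mem: "(i mod m, i div m mod p) \<in> {..<m} \<times> {..<p}" for i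
    using m p by simp
  show "range ?h = X"
  proof
    show "range ?h \<subseteq> X" using g mem by (auto simp: bij_betw_def)
    show "X \<subseteq> range ?h"
    proof
      fix x assume "x \<in> X"
      then obtain s j where sj: "s < m" "j < p" "x = g (s, j)" using g by (auto simp: bij_betw_def)
      then have "?h (s + j * m) = x" by simp
      then show "x \<in> range ?h" by blast
    qed
  qed
  have "?h i = ?h j \<longleftrightarrow> i mod m = j mod m \<and> i div m mod p = j div m mod p"
    using g mem[of i] mem[of j] by (auto simp: bij_betw_def dest: inj_onD)
  also have "\<dots> \<longleftrightarrow> i mod (m * p) = j mod (m * p)"
  proof
    assume eq: "i mod (m * p) = j mod (m * p)"
    have "k mod (m * p) mod m = k mod m" "k mod (m * p) div m = k div m mod p" for k
      using m by (auto simp: mod_mult2_eq)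
    with eq show "i mod m = j mod m \<and> i div m mod p = j div m mod p" by metis
  qed (simp add: mod_mult2_eq)
  finally show "?h i = ?h j \<longleftrightarrow> i mod (m * p) = j mod (m * p)" .
qed

text \<open>For \<open>p > 1\<close> this is the cycle
  \<open>(0, 0), (1, 0), ..., (m - 1, 0), (0, 1)\<close> of length \<open>m + 1\<close>; all other
  cells are fixed. It links the rows, which the row shift alone preserves.\<close>

definition twist :: "nat \<Rightarrow> nat \<times> nat \<Rightarrow> nat \<times> nat" where
  "twist m = (\<lambda>(s, j). if j = 0 then if Suc s < m then (Suc s, 0) else (0, 1)
     else if s = 0 \<and> j = 1 then (0, 0) else (s, j))"

lemma bij_betw_twist:
  assumes "m > 0" "p > 1"
  shows "bij_betw (twist m) ({..<m} \<times> {..<p}) ({..<m} \<times> {..<p})"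
proof -
  have "inj_on (twist m) ({..<m} \<times> {..<p})"
    by (auto simp: inj_on_def twist_def split: if_splits)
  moreover have "twist m ` ({..<m} \<times> {..<p}) \<subseteq> {..<m} \<times> {..<p}"
    using assms by (auto simp: twist_def split: if_splits)
  ultimately show ?thesis using endo_inj_surj[of "{..<m} \<times> {..<p}" "twist m"]
    unfolding bij_betw_def by blast
qed

text \<open>The row shift and its conjugate by \<open>twist\<close> generate a transitive group: the
  first moves within a row, the second leads from each row to the next and from the last one back to
  row 0.\<close>

lemma grid_transitive:
  fixes P :: "nat \<times> nat \<Rightarrow> bool"
  assumes m: "m > 0" and p: "p \<ge> 3"
    and row: "\<And>s j. P (s, j) \<Longrightarrow> s < m \<Longrightarrow> j < p \<Longrightarrow> P (s, Suc j mod p)"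
    and col: "\<And>s j. P (twist m (s, j)) \<Longrightarrow> s < m \<Longrightarrow> j < p \<Longrightarrow> P (twist m (s, Suc j mod p))"
    and start: "P (s\<^sub>0, j\<^sub>0)" "s\<^sub>0 < m" "j\<^sub>0 < p"
    and s: "s < m" and j: "j < p"
  shows "P (s, j)"
proof -
  have rows: "P (s, j')" if "P (s, j)" "s < m" "j < p" "j' < p" for s j j'
  proof -
    have "P (s, (j + t) mod p)" for t
    proof (induction t)
      case (Suc t)
      have "P (s, Suc ((j + t) mod p) mod p)" using row[OF Suc that(2)] p by simp
      then show ?case by (simp add: mod_Suc_eq)
    qed (use that in simp)
    from this[of "j' + p - j"] show ?thesis using that by simp
  qed
  \<comment> \<open>The conjugate shift sends \<open>(s, p - 1)\<close> to
    \<open>twist m (s, 0)\<close>: \<open>p \<ge> 3\<close> makes \<open>p - 1\<close> differ from 0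
    and 1, so \<open>twist\<close> fixes \<open>(s, p - 1)\<close>.\<close>
  have step: "P (if Suc s < m then (Suc s, 0) else (0, 1))" if "P (s, j)" "s < m" "j < p" for s j
  proof -
    have "twist m (s, p - 1) = (s, p - 1)" using p by (auto simp: twist_def)
    then have "P (twist m (s, p - 1))" using rows[OF that] p by simp
    from col[OF this that(2)] show ?thesis using p by (simp add: twist_def)
  qed
  have up: "P (s + t, 0)" if "P (s, j)" "j < p" "s + t < m" for s j t
    using that(3)
  proof (induction t)
    case 0
    show ?case using rows[OF that(1)] that p 0 by simp
  next
    case (Suc t)
    then show ?case using step[of "s + t" 0] p by simp
  qed
  have "P (m - 1, 0)" using up[OF start(1,3), of "m - 1 - s\<^sub>0"] start(2) by simp
  then have "P (0, 1)" using step[of "m - 1" 0] m p by simp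
  then have "P (s, 0)" using up[of 0 1 s] p s by simp
  then show ?thesis using rows s j p by simp
qed

text \<open>
  With \<open>\<alpha>\<close> the row shift and \<open>\<beta>\<close> its conjugate by \<^const>\<open>twist\<close>, the cell \<open>(0, 0)\<close> is the only one
  at which \<open>\<beta>\<close> and \<open>\<alpha>\<^sup>2\<close> agree, so it is fixed by everything that commutes with both.
\<close>

lemma twist_shift_eq_double_shift:
  assumes m: "m \<ge> 2" and p: "p \<ge> 3" and sj: "s < m" "j < p"
    and tw: "twist m (s, j) = (s', j')" "twist m (s, Suc j mod p) = (s', Suc (Suc j') mod p)"
  shows "(s', j') = (0, 0)"
proof -
  \<comment> \<open>Outside the middle case, either \<open>twist\<close> changes the row of exactly
    one of the two neighbouring cells, or it fixes both and a shift by one would equal a shift by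
    two.\<close>
  consider "j = 0" | "s = 0" "j = 1" | "j \<noteq> 0" "\<not> (s = 0 \<and> j = 1)" by blast
  then show ?thesis
  proof cases
    case 1
    then have "s' = (if Suc s < m then Suc s else 0)"
      using tw(1) by (simp add: twist_def split: if_splits)
    moreover have "s' = s" using 1 tw(2) p by (simp add: twist_def split: if_splits)
    ultimately show ?thesis using m sj(1) by (simp split: if_splits)
  next
    case 2
    then show ?thesis using tw(1) by (simp add: twist_def)
  next
    case 3
    then have eq: "s' = s" "j' = j" using tw(1) by (auto simp: twist_def)
    show ?thesis
    proof (cases "Suc j = p")
      case True
      then have "s' = (if Suc s < m then Suc s else 0)"
        using tw(2) by (simp add: twist_def split: if_splits)
      then show ?thesis using eq m sj(1) by (simp split: if_splits)
    next
      case False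
      then have "Suc j = Suc (Suc j) mod p"
        using tw(2) eq 3 sj(2) by (simp add: twist_def split: if_splits)
      then show ?thesis using False sj(2) by (simp add: mod_Suc split: if_splits)
    qed
  qed
qed

text \<open>\<open>R\<close> is the graph of a partial map commuting with both shifts. Transitivity
  is used twice: its domain is invariant, hence the whole grid, and so is its set of fixed points
  once \<open>(0, 0)\<close> is known to be fixed.\<close>

lemma grid_rigid:
  fixes R :: "nat \<times> nat \<Rightarrow> nat \<times> nat \<Rightarrow> bool"
  assumes m: "m \<ge> 2" and p: "p \<ge> 3"
    and fld: "\<And>u v. R u v \<Longrightarrow> u \<in> {..<m} \<times> {..<p} \<and> v \<in> {..<m} \<times> {..<p}"
    and fn: "\<And>u v w. R u v \<Longrightarrow> R u w \<Longrightarrow> v = w"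
    and row: "\<And>s j s' j'. R (s, j) (s', j') \<Longrightarrow> R (s, Suc j mod p) (s', Suc j' mod p)"
    and col: "\<And>s j s' j'. R (twist m (s, j)) (twist m (s', j')) \<Longrightarrow>
      s < m \<Longrightarrow> j < p \<Longrightarrow> s' < m \<Longrightarrow> j' < p \<Longrightarrow>
      R (twist m (s, Suc j mod p)) (twist m (s', Suc j' mod p))"
    and R: "R u v" and w: "w \<in> {..<m} \<times> {..<p}"
  shows "R w w"
proof -
  have m0: "m > 0" using m by simp
  have tw: "\<exists>s j. s < m \<and> j < p \<and> v = twist m (s, j)" if "v \<in> {..<m} \<times> {..<p}" for v
    proof -
    have "v \<in> twist m ` ({..<m} \<times> {..<p})"
      using that bij_betw_twist[of m p] m0 p by (simp add: bij_betw_def)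
    then show ?thesis by auto
  qed
  have "\<exists>v. R (s, j) v" if "s < m" "j < p" for s j
  proof (rule grid_transitive[where P = "\<lambda>u. \<exists>v. R u v", OF m0 p _ _ _ _ _ that])
    show "\<exists>v. R (s, Suc j mod p) v" if "\<exists>v. R (s, j) v" for s j
      using that row by (metis surj_pair)
    show "\<exists>v. R (twist m (s, Suc j mod p)) v"
      if "\<exists>v. R (twist m (s, j)) v" "s < m" "j < p" for s j
      using that col fld tw by metis
    show "\<exists>v. R (fst u, snd u) v" "fst u < m" "snd u < p"
      using R fld[OF R] by auto
  qed
  then obtain v where v: "R (0, 0) v" using m p by (metis less_le_trans zero_less_numeral)
  obtain s j where sj: "s < m" "j < p" "v = twist m (s, j)" using tw fld[OF v] by blast
  obtain s' j' where v': "v = (s', j')" by fastforce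
  \<comment> \<open>The conjugate shift takes \<open>(0, 0) = twist m (0, 1)\<close> to
    \<open>twist m (0, 2) = (0, 2)\<close>, which is also the double row shift of
    \<open>(0, 0)\<close>. The image \<open>v\<close> of \<open>(0, 0)\<close> inherits this
    agreement.\<close>
  have tw2: "twist m (0, Suc 1 mod p) = (0, 2)" using p by (simp add: twist_def)
  have "twist m (0, 1) = (0, 0)" by (simp add: twist_def)
  then have "R (twist m (0, 1)) (twist m (s, j))" using v sj by simp
  from col[OF this m0 _ sj(1,2)] have "R (0, 2) (twist m (s, Suc j mod p))"
    using p by (simp only: tw2)
  moreover have "R (0, 2) (s', Suc (Suc j') mod p)"
    using row[OF row[OF v[unfolded v']]] p by (simp add: mod_Suc_eq numeral_2_eq_2)
  ultimately have "twist m (s, Suc j mod p) = (s', Suc (Suc j') mod p)" by (rule fn)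
  then have "v = (0, 0)"
    using twist_shift_eq_double_shift[OF m p sj(1,2)] sj(3) v' by metis
  with v have R0: "R (0, 0) (0, 0)" by simp
  have "R (s, j) (s, j)" if "s < m" "j < p" for s j
    by (rule grid_transitive[where P = "\<lambda>u. R u u", OF m0 p _ _ R0 _ _ that])
      (use row col m p in auto)
  then show ?thesis using w by auto
qed

section \<open>The two bounds on the distance\<close>

lemma commuting_rel_sym: "(a, b) \<in> commuting_rel S \<Longrightarrow> (b, a) \<in> commuting_rel S"
  by (simp add: commuting_rel_def)

lemma commuting_rel_relpow_le_5:
  assumes fin: "finite X" and card: "card X = p ^ k" and p: "prime p" "odd p" and k: "k \<ge> 2"
    and u: "u \<in> carrier (sym_inv_semigroup X)" "u \<noteq> Map.empty" "u \<noteq> Some |` X"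
    and v: "v \<in> carrier (sym_inv_semigroup X)" "v \<noteq> Map.empty" "v \<noteq> Some |` X"
  shows "(u, v) \<in> commuting_rel (sym_inv_semigroup X) ^^ 5"
proof -
  let ?C = "commuting_rel (sym_inv_semigroup X)"
  have "p \<ge> 2" using p by (simp add: prime_ge_2_nat)
  then have p3: "p \<ge> 3" using p(2) by (cases "p = 2") auto
  have "p ^ 1 \<le> p ^ k" using p3 k by (intro power_increasing) auto
  then have c3: "card X \<ge> 3" using p3 card by simp
  have near: "\<exists>A. A \<subseteq> X \<and> A \<noteq> {} \<and> A \<noteq> X \<and> (f, Some |` A) \<in> ?C ^^ 2"
    if "f \<in> carrier (sym_inv_semigroup X)" "f \<noteq> Map.empty" "f \<noteq> Some |` X" for f
    using that commuting_rel_relpow_idempotent_nonperm[OF fin c3 that(1,2)]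
      commuting_rel_relpow_idempotent_perm[OF fin card p(1) k that(1,3)] by blast
  obtain A where A: "A \<subseteq> X" "A \<noteq> {}" "A \<noteq> X" "(u, Some |` A) \<in> ?C ^^ 2" using near[OF u] by blast
  obtain B where B: "B \<subseteq> X" "B \<noteq> {}" "B \<noteq> X" "(v, Some |` B) \<in> ?C ^^ 2" using near[OF v] by blast
  obtain w where "(v, w) \<in> ?C" "(w, Some |` B) \<in> ?C" using B(4) by (auto simp: numeral_2_eq_2)
  then have "(Some |` B, v) \<in> ?C ^^ 2"
    using commuting_rel_sym by (fastforce simp: numeral_2_eq_2)
  moreover have "(Some |` A, Some |` B) \<in> ?C ^^ 1"
    using commuting_rel_idempotents[OF A(1-3) B(1-3)] by simp
  ultimately have "(u, v) \<in> ?C ^^ (2 + (1 + 2))" using A(4) by (blast intro: relpow_trans)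
  then show ?thesis by simp
qed

text \<open>The cycles follow a numbering of the grid and its image under \<open>twist\<close>, so
  their \<open>m\<close>-th powers are the two shifts of \<open>grid_rigid\<close>. The midpoint of
  a walk of length 4 commutes with both powers and is therefore the identity, which is
  central.\<close>

lemma ex_not_commuting_rel_relpow_4:
  fixes X :: "'a set"
  assumes fin: "finite X" and card: "card X = p ^ k" and p: "prime p" "odd p" and k: "k \<ge> 2"
  shows "\<exists>\<sigma> \<rho>. \<sigma> \<in> carrier (sym_inv_semigroup X) \<and> \<sigma> \<noteq> Map.empty \<and> \<sigma> \<noteq> Some |` X \<and>
    \<rho> \<in> carrier (sym_inv_semigroup X) \<and> \<rho> \<noteq> Map.empty \<and> \<rho> \<noteq> Some |` X \<and>
    (\<sigma>, \<rho>) \<notin> commuting_rel (sym_inv_semigroup X) ^^ 4"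
proof -
  let ?C = "commuting_rel (sym_inv_semigroup X)"
  define m where "m = p ^ (k - 1)"
  let ?G = "{..<m} \<times> {..<p}"
  have p2: "p \<ge> 2" using p by (simp add: prime_ge_2_nat)
  then have p3: "p \<ge> 3" using p(2) by (cases "p = 2") auto
  have "p ^ 1 \<le> m" unfolding m_def using p3 k by (intro power_increasing) auto
  then have m: "m \<ge> 2" using p3 by simp
  have mp: "m * p = p ^ k" using k by (simp add: m_def flip: power_Suc2)
  have "2 * 2 \<le> m * p" using m p2 by (rule mult_le_mono)
  then have n2: "p ^ k \<ge> 2" using mp by simp
  obtain g where g: "bij_betw g ?G X"
    using finite_same_card_bij[of ?G X] fin card mp by (auto simp: card_cartesian_product)
  define g' where "g' = g \<circ> twist m"
  have tw: "bij_betw (twist m) ?G ?G" using bij_betw_twist m p2 by simp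
  then have g': "bij_betw g' ?G X" using g unfolding g'_def by (rule bij_betw_trans)
  let ?h = "\<lambda>f i. (f (i mod m, i div m mod p) :: 'a)"
  have h: "range (?h f) = X" "\<And>i j. ?h f i = ?h f j \<longleftrightarrow> i mod p ^ k = j mod p ^ k"
    if "bij_betw f ?G X" for f
    using grid_enumeration[OF that] m p2 unfolding mp by auto
  obtain \<sigma> where \<sigma>: "\<sigma> \<in> carrier (sym_inv_semigroup X)" "\<sigma> \<noteq> Map.empty" "\<sigma> \<noteq> Some |` X"
    "\<And>i. \<sigma> (?h g i) = Some (?h g (Suc i))"
    using ex_cycle[OF n2 h[OF g]] by blast
  obtain \<rho> where \<rho>: "\<rho> \<in> carrier (sym_inv_semigroup X)" "\<rho> \<noteq> Map.empty" "\<rho> \<noteq> Some |` X"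
    "\<And>i. \<rho> (?h g' i) = Some (?h g' (Suc i))"
    using ex_cycle[OF n2 h[OF g']] by blast
  have "(\<sigma>, \<rho>) \<notin> ?C ^^ 4"
  proof
    assume "(\<sigma>, \<rho>) \<in> ?C ^^ 4"
    then obtain c d e where cde: "(\<sigma>, c) \<in> ?C" "(c, d) \<in> ?C" "(d, e) \<in> ?C" "(e, \<rho>) \<in> ?C"
      by (auto simp: eval_nat_numeral)
    \<comment> \<open>Stated for any numbering \<open>f\<close>, as it serves for
      \<open>\<sigma>\<close> through \<open>c\<close> and for \<open>\<rho>\<close> through
      \<open>e\<close>.\<close>
    have shift: "d (f (s, Suc j mod p)) = Some (f (s', Suc j' mod p))"
      if f: "bij_betw f ?G X" and \<tau>: "\<And>i. \<tau> (?h f i) = Some (?h f (Suc i))"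
        and C: "(\<tau>, b) \<in> ?C" "(b, d) \<in> ?C"
        and d: "d (f (s, j)) = Some (f (s', j'))" and lt: "s < m" "j < p" "s' < m" "j' < p"
      for f \<tau> b s j s' j'
    proof -
      have cell: "?h f (s + j * m) = f (s, j)" "?h f (s + j * m + m) = f (s, Suc j mod p)"
        if "s < m" "j < p" for s j
        using that by simp_all
      have "d (?h f (s + j * m)) = Some (?h f (s' + j' * m))"
        using d lt by (simp only: cell)
      from cycle_second_centralizer[OF p(1) h[OF f] \<tau> C this]
      show ?thesis using lt by (simp only: cell flip: m_def)
    qed
    have dX: "d \<in> carrier (sym_inv_semigroup X)" "d \<noteq> Map.empty" "d \<noteq> Some |` X"
      using cde(2) by (simp_all add: commuting_rel_sym_inv_semigroup)
    then have dom: "dom d \<subseteq> X" "ran d \<subseteq> X" by (auto simp: carrier_sym_inv_semigroup)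
    define R where "R u v \<longleftrightarrow> u \<in> ?G \<and> v \<in> ?G \<and> d (g u) = Some (g v)" for u v
    obtain x y where xy: "d x = Some y" using dX(2) by fastforce
    then have "x \<in> X" "y \<in> X" using dom by (auto intro: ranI)
    then obtain u v where "u \<in> ?G" "v \<in> ?G" "x = g u" "y = g v" using g by (auto simp: bij_betw_def)
    with xy have Ruv: "R u v" by (simp add: R_def)
    have Rww: "R w w" if "w \<in> ?G" for w
    proof (rule grid_rigid[where R = R, OF m p3 _ _ _ _ Ruv that])
      show "u \<in> ?G \<and> v \<in> ?G" if "R u v" for u v using that by (simp add: R_def)
      show "v = w" if "R u v" "R u w" for u v w
        using that g by (auto simp: R_def bij_betw_def dest: inj_onD)
      show "R (s, Suc j mod p) (s', Suc j' mod p)" if "R (s, j) (s', j')" for s j s' j'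
        using that shift[OF g \<sigma>(4) cde(1,2)] p2 by (auto simp: R_def)
      show "R (twist m (s, Suc j mod p)) (twist m (s', Suc j' mod p))"
        if R: "R (twist m (s, j)) (twist m (s', j'))" and lt: "s < m" "j < p" "s' < m" "j' < p"
        for s j s' j'
      proof -
        have "d (g' (s, j)) = Some (g' (s', j'))" using R by (simp add: R_def g'_def)
        \<comment> \<open>The second half of the walk is read backwards, starting from
          \<open>\<rho>\<close>.\<close>
        from shift[OF g' \<rho>(4) commuting_rel_sym[OF cde(4)] commuting_rel_sym[OF cde(3)] this lt]
        have "d (g' (s, Suc j mod p)) = Some (g' (s', Suc j' mod p))" .
        moreover have "twist m (s, j) \<in> ?G" if "s < m" "j < p" for s j
          using bij_betwE[OF tw] that by blast
        ultimately show ?thesis using lt p2 by (simp add: R_def g'_def)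
      qed
    qed
    have "d x = Some x" if "x \<in> X" for x
      using that g Rww by (auto simp: bij_betw_def R_def)
    moreover have "d x = None" if "x \<notin> X" for x using that dom(1) by auto
    ultimately have "d = Some |` X" by (auto simp: fun_eq_iff restrict_map_def)
    with dX(3) show False ..
  qed
  with \<sigma> \<rho> show ?thesis by blast
qed

theorem theorem6p16:
  fixes X :: "'a set" and p k :: nat
  assumes "finite X"
    and "card X = p ^ k"
    and "prime p" and "odd p"
    and "k \<ge> 2"
  shows "graph_diameter (with_proj (commuting_graph (sym_inv_semigroup X))) = 5"
proof -
  let ?S = "sym_inv_semigroup X"
  let ?G = "with_proj (commuting_graph ?S)"
  have verts: "u \<in> verts ?G \<longleftrightarrow> u \<in> carrier ?S \<and> u \<noteq> Map.empty \<and> u \<noteq> Some |` X" for u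
    by (auto simp: commuting_graph_def semigroup_center_sym_inv_semigroup)
  have vertsD: "u \<in> carrier ?S - semigroup_center ?S" if "u \<in> verts ?G" for u
    using that by (simp add: commuting_graph_def)
  show ?thesis
  proof (rule antisym)
    show "graph_diameter ?G \<le> 5"
      unfolding graph_diameter_def
    proof (intro SUP_least)
      fix u v assume uv: "u \<in> verts ?G" "v \<in> verts ?G"
      then have "(u, v) \<in> commuting_rel ?S ^^ 5"
        using commuting_rel_relpow_le_5[OF assms] verts by blast
      from graph_dist_le_if_commuting_rel[OF this vertsD[OF uv(1)]]
      show "graph_dist ?G u v \<le> 5" by simp
    qed
    obtain \<sigma> \<rho> where "\<sigma> \<in> verts ?G" "\<rho> \<in> verts ?G" and far: "(\<sigma>, \<rho>) \<notin> commuting_rel ?S ^^ 4"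
      using ex_not_commuting_rel_relpow_4[OF assms] verts by blast
    then show "5 \<le> graph_diameter ?G"
      unfolding graph_diameter_def
      using graph_dist_ge_if_not_commuting_rel[OF far] by (intro SUP_upper2[of \<sigma>] SUP_upper2[of \<rho>]) auto
  qed
qed

end
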